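(* If $X$ is a polyadic space, then $dd(X) = [d(X), w(X)]$; that is, for every cardinal $\lambda$, there is a dense subspace $D$ of $X$ with $d(D) = \lambda$ if and only if $d(X) \le \lambda \le w(X)$.
   Context: For a topological space $X$, $d(X)$ denotes its density (the least cardinality of a dense subset) and $w(X)$ its weight (the least cardinality of a base). The double density spectrum of $X$ is $dd(X) = \{d(D) : D \text{ is a dense subspace of } X\}$. For cardinals $\alpha \le \beta$, $[\alpha,\beta]$ denotes the set of all cardinals $\lambda$ with $\alpha \le \lambda \le \beta$. Compact spaces are assumed Hausdorff. For an infinite cardinal $\mu$, $A(\mu)$ denotes the Alexandrov one-point compactification of the discrete space of size $\mu$. A (compact) space is $\mu$-adic if it is a continuous image of some power $A(\mu)^\kappa$ of $A(\mu)$; a space is polyadic if it is $\mu$-adic for some infinite cardinal $\mu$. *)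

theory Defs
  imports "HOL-Analysis.Analysis"
begin

unbundle cardinal_syntax

text \<open>Cardinals are cardinal orders (\<^const>\<open>card_order_on\<close>), identified up to \<open>=o\<close>; comparisons
  between cardinal orders on different types use \<open>\<le>o\<close>.\<close>

definition least_card :: "'b set set \<Rightarrow> 'b rel" where
  "least_card \<A> = |SOME A. A \<in> \<A> \<and> (\<forall>B\<in>\<A>. |A| \<le>o |B| )|"

lemma least_card_attained:
  assumes "\<A> \<noteq> {}"
  shows "\<exists>A\<in>\<A>. least_card \<A> = |A| \<and> (\<forall>B\<in>\<A>. |A| \<le>o |B| )"
proof -
  have "\<exists>r\<in>card_of ` \<A>. \<forall>r'\<in>card_of ` \<A>. r \<le>o r'"
    by (rule exists_minim_Card_order) (use assms card_of_Card_order in auto)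
  then have "\<exists>A. A \<in> \<A> \<and> (\<forall>B\<in>\<A>. |A| \<le>o |B| )" by auto
  from someI_ex[OF this] show ?thesis unfolding least_card_def by auto
qed

definition dense_subset :: "'a topology \<Rightarrow> 'a set \<Rightarrow> bool" where
  "dense_subset X D \<longleftrightarrow> D \<subseteq> topspace X \<and> X closure_of D = topspace X"

definition topology_base :: "'a topology \<Rightarrow> 'a set set \<Rightarrow> bool" where
  "topology_base X \<B> \<longleftrightarrow> openin X = arbitrary union_of (\<lambda>U. U \<in> \<B>)"

definition topological_density :: "'a topology \<Rightarrow> 'a rel" where
  "topological_density X = least_card {D. dense_subset X D}"

definition topological_weight :: "'a topology \<Rightarrow> 'a set rel" where
  "topological_weight X = least_card {\<B>. topology_base X \<B>}"

lemma topological_density_attained: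
  "\<exists>D. dense_subset X D \<and> topological_density X = |D| \<and> (\<forall>E. dense_subset X E \<longrightarrow> |D| \<le>o |E| )"
proof -
  have "dense_subset X (topspace X)"
    by (simp add: dense_subset_def)
  then have "{D. dense_subset X D} \<noteq> {}" by blast
  from least_card_attained[OF this] show ?thesis unfolding topological_density_def by auto
qed

lemma topological_weight_attained:
  "\<exists>\<B>. topology_base X \<B> \<and> topological_weight X = |\<B>| \<and> (\<forall>\<C>. topology_base X \<C> \<longrightarrow> |\<B>| \<le>o |\<C>| )"
proof -
  have "topology_base X {U. openin X U}"
    unfolding topology_base_def openin_topology_base_unique by blast
  then have "{\<B>. topology_base X \<B>} \<noteq> {}" by blast
  from least_card_attained[OF this] show ?thesis unfolding topological_weight_def by auto
qed

text \<open>A set of cardinals collects the cardinal orders on subsets of a type \<open>'l\<close>, which is unrelated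
  to the type of points: every cardinal is such an order for a suitable \<open>'l\<close>, so a statement about
  these sets that is polymorphic in \<open>'l\<close> speaks about all cardinals.\<close>

definition double_density_spectrum :: "'a topology \<Rightarrow> 'l rel set" where
  "double_density_spectrum X =
     {\<nu>. Card_order \<nu> \<and> (\<exists>D. dense_subset X D \<and> topological_density (subtopology X D) =o \<nu>)}"

definition cardinal_interval :: "'b rel \<Rightarrow> 'c rel \<Rightarrow> 'l rel set" where
  "cardinal_interval \<alpha> \<beta> = {\<nu>. Card_order \<nu> \<and> \<alpha> \<le>o \<nu> \<and> \<nu> \<le>o \<beta>}"

text \<open>The infinite set \<open>M\<close> carries the discrete topology and plays the role of \<open>\<mu>\<close>; the index set
  \<open>K\<close> plays the role of \<open>\<kappa>\<close>.\<close>

definition adic :: "'m set \<Rightarrow> 'k itself \<Rightarrow> 'a topology \<Rightarrow> bool" where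
  "adic M TYPE('k) X \<longleftrightarrow>
     compact_space X \<and> Hausdorff_space X \<and>
     (\<exists>(K :: 'k set) f.
        continuous_map
          (product_topology (\<lambda>_. Alexandroff_compactification (discrete_topology M)) K) X f \<and>
        f ` topspace (product_topology (\<lambda>_. Alexandroff_compactification (discrete_topology M)) K)
          = topspace X)"

text \<open>HOL cannot quantify over types inside a formula, so the types from which \<open>\<mu>\<close> and \<open>\<kappa>\<close> are
  drawn are parameters. A theorem assuming this predicate for type variables \<open>'m\<close> and \<open>'k\<close>
  covers all \<open>\<mu>\<close> and all \<open>\<kappa>\<close>.\<close>

definition polyadic :: "'m itself \<Rightarrow> 'k itself \<Rightarrow> 'a topology \<Rightarrow> bool" where
  "polyadic TYPE('m) TYPE('k) X \<longleftrightarrow> (\<exists>M :: 'm set. infinite M \<and> adic M TYPE('k) X)"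

end

theory Submission
  imports Defs
begin

text \<open>
  The inclusion of the spectrum in the interval holds in every space: a dense subset of a dense
  subspace is dense in the whole space, and the density of a subspace is at most the weight of the
  space. If \<open>X\<close> is finite, it is discrete, and its density and weight agree. The
  substance is to find, for an infinite polyadic \<open>X\<close> and a cardinal \<open>\<nu>\<close> between density and weight,
  which is then infinite, a dense subspace of density exactly \<open>\<nu>\<close>. Let \<open>f\<close> map the power \<open>Z\<close> of
  \<open>A(M)\<close> with index set \<open>K\<close> continuously onto \<open>X\<close>.

  First, the weight is turned into a combinatorial object. Call a product of two disjoint open sets
  a box. If boxes cover all pairs of distinct points of an infinite compact Hausdorff space, then
  there are at least as many of them as the weight (\<open>weight_le_separating_boxes\<close>). Well-order all
  boxes and keep those that contain a pair outside all earlier boxes. The kept boxes still cover, so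
  \<open>\<nu>\<close> of them can be chosen: a family \<open>T\<close> of boxes \<open>W\<close> with pairs \<open>(x W, y W) \<in> W\<close> such
  that for two different boxes of \<open>T\<close> the pair of one of them lies outside the other
  (\<open>exists_right_separated_boxes\<close>).

  By compactness of \<open>Z\<close>, finitely many tests of the form ``is \<open>z j = Some m\<close>?'' distinguish the
  points that \<open>f\<close> sends to \<open>x W\<close> from those that it sends outside the first side of \<open>W\<close>, and
  likewise for \<open>y W\<close> (\<open>finite_tests_separate_closed\<close>). Let \<open>J\<close> be the set of coordinates that
  occur in the tests of all boxes in \<open>T\<close>; it has at most \<open>\<nu>\<close> elements.

  Lift a dense subset of \<open>X\<close> of least size to a set \<open>P \<subseteq> Z\<close>, and replace each \<open>p \<in> P\<close> by the
  points that agree with \<open>p\<close> off \<open>J\<close> and on a finite part of \<open>J\<close> and take the value \<open>None\<close> on the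
  rest of \<open>J\<close>. These points accumulate at \<open>p\<close>, so their images form a dense set \<open>D\<close>, of size at
  most \<open>\<nu>\<close>. Suppose that the images of a set of fewer than \<open>\<nu>\<close> of them were dense in \<open>X\<close>, and let
  \<open>C\<close> be the closure of that set in \<open>Z\<close>. Then \<open>f\<close> maps \<open>C\<close> onto \<open>X\<close>, while only fewer than \<open>\<nu>\<close>
  tests with coordinate in \<open>J\<close> ever succeed on \<open>C\<close>. Recording which tests succeed on the fibres of
  \<open>x W\<close> and \<open>y W\<close> then gives fewer than \<open>\<nu>\<close> codes, so two boxes of \<open>T\<close> share a code; each then
  contains the pair of the other, contrary to the choice of \<open>T\<close>
  (\<open>separated_boxes_le_tests\<close>, \<open>card_le_dense_truncations\<close>). Hence \<open>D\<close> has density \<open>\<nu>\<close>.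
\<close>

section \<open>Cardinalities of families of finite sets\<close>

text \<open>A finite subset is the set of entries of a list, and there are only countably many lengths.\<close>

lemma card_of_Fpow_ordLeq_infinite:
  assumes "infinite A"
  shows "|Fpow A| \<le>o |A|"
proof -
  let ?L = "\<lambda>n. {xs. set xs \<subseteq> A \<and> length xs = n}"
  have "|?L n| \<le>o |A|" for n
  proof (induction n)
    case 0
    have "?L 0 = {[]}" by auto
    with assms show ?case by (simp add: card_of_singl_ordLeq infinite_imp_nonempty)
  next
    case (Suc n)
    have "?L (Suc n) \<subseteq> (\<lambda>(x, xs). x # xs) ` (A \<times> ?L n)"
      by (force simp: length_Suc_conv)
    then have "|?L (Suc n)| \<le>o |A \<times> ?L n|" by (rule surj_imp_ordLeq)
    also have "|A \<times> ?L n| \<le>o |A|"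
      using assms Suc by (intro card_of_Sigma_ordLeq_infinite) (auto intro: ordLeq_refl card_of_Card_order)
    finally show ?case .
  qed
  then have "|\<Union>n. ?L n| \<le>o |A|"
    using assms by (intro card_of_UNION_ordLeq_infinite) (auto simp: infinite_iff_card_of_nat)
  moreover have "Fpow A \<subseteq> set ` (\<Union>n. ?L n)"
    by (auto simp: Fpow_def image_iff) (metis finite_list)
  then have "|Fpow A| \<le>o |\<Union>n. ?L n|" by (rule surj_imp_ordLeq)
  ultimately show ?thesis using ordLeq_transitive by blast
qed

lemma card_of_finite_ordLeq_infinite: "finite A \<Longrightarrow> infinite B \<Longrightarrow> |A| \<le>o |B|"
  using ordLeq_total[OF card_of_Well_order card_of_Well_order] card_of_ordLeq_finite by blast

lemma finite_Fpow: "finite A \<Longrightarrow> finite (Fpow A)"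
  by (simp add: Fpow_Pow_finite)

lemma infinite_Fpow: "infinite A \<Longrightarrow> infinite (Fpow A)"
proof -
  assume "infinite A"
  moreover have "inj_on (\<lambda>a. {a}) A" "(\<lambda>a. {a}) ` A \<subseteq> Fpow A" by (auto simp: Fpow_def)
  ultimately show ?thesis by (meson inj_on_finite)
qed

section \<open>Density and weight\<close>

lemma dense_subset_iff:
  "dense_subset X D \<longleftrightarrow> D \<subseteq> topspace X \<and> (\<forall>U. openin X U \<and> U \<noteq> {} \<longrightarrow> D \<inter> U \<noteq> {})"
  by (simp add: dense_subset_def dense_intersects_open)

lemma topological_density_le: "dense_subset X D \<Longrightarrow> topological_density X \<le>o |D|"
  using topological_density_attained[of X] by auto

lemma topological_weight_le: "topology_base X \<B> \<Longrightarrow> topological_weight X \<le>o |\<B>|"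
  using topological_weight_attained[of X] by auto

lemma topology_base_iff:
  "topology_base X \<B> \<longleftrightarrow>
     (\<forall>B\<in>\<B>. openin X B) \<and> (\<forall>U x. openin X U \<and> x \<in> U \<longrightarrow> (\<exists>B\<in>\<B>. x \<in> B \<and> B \<subseteq> U))"
  unfolding topology_base_def openin_topology_base_unique[of X "\<lambda>U. U \<in> \<B>"] by blast

lemma dense_subset_trans:
  assumes "dense_subset X D" "dense_subset (subtopology X D) E"
  shows "dense_subset X E"
proof -
  have D: "D \<subseteq> topspace X" using assms(1) by (simp add: dense_subset_def)
  have "E \<inter> U \<noteq> {}" if "openin X U" "U \<noteq> {}" for U
  proof -
    have "openin (subtopology X D) (D \<inter> U)"
      using that by (simp add: openin_subtopology_Int2)
    moreover have "D \<inter> U \<noteq> {}" using assms(1) that by (simp add: dense_subset_iff)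
    ultimately show ?thesis using assms(2) unfolding dense_subset_iff by blast
  qed
  then show ?thesis using assms(2) D by (auto simp: dense_subset_iff)
qed

lemma topological_density_dense_subspace_ge:
  assumes "dense_subset X D"
  shows "topological_density X \<le>o topological_density (subtopology X D)"
  using topological_density_attained[of "subtopology X D"]
    dense_subset_trans[OF assms] topological_density_le by metis

lemma topological_density_subspace_le_weight:
  assumes "D \<subseteq> topspace X"
  shows "topological_density (subtopology X D) \<le>o topological_weight X"
proof -
  obtain \<B> where B: "topology_base X \<B>" "topological_weight X = |\<B>|"
    using topological_weight_attained by blast
  define c where "c B = (SOME x. x \<in> B \<inter> D)" for B
  have c: "c B \<in> B \<inter> D" if "B \<inter> D \<noteq> {}" for B
    using that some_in_eq unfolding c_def by blast
  let ?E = "c ` {B \<in> \<B>. B \<inter> D \<noteq> {}}"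
  have "dense_subset (subtopology X D) ?E"
    unfolding dense_subset_iff
  proof (intro conjI allI impI)
    show "?E \<subseteq> topspace (subtopology X D)" using c assms by auto
  next
    fix U assume "openin (subtopology X D) U \<and> U \<noteq> {}"
    then obtain V x where "openin X V" "U = V \<inter> D" "x \<in> U" by (auto simp: openin_subtopology)
    then obtain B where "B \<in> \<B>" "x \<in> B" "B \<subseteq> V"
      using B(1) unfolding topology_base_iff by blast
    then show "?E \<inter> U \<noteq> {}" using c[of B] \<open>x \<in> U\<close> \<open>U = V \<inter> D\<close> by blast
  qed
  then have "topological_density (subtopology X D) \<le>o |?E|" by (rule topological_density_le)
  also have "|?E| \<le>o |{B \<in> \<B>. B \<inter> D \<noteq> {}}|" by (rule card_of_image)
  also have "|{B \<in> \<B>. B \<inter> D \<noteq> {}}| \<le>o |\<B>|" by (rule card_of_mono1) auto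
  finally show ?thesis using B(2) by simp
qed

text \<open>Finite Hausdorff spaces are discrete, so the interval between density and weight is a single
  point.\<close>

lemma finite_Hausdorff_density_weight:
  assumes "Hausdorff_space X" "finite (topspace X)"
  shows "topological_weight X \<le>o topological_density X"
proof -
  obtain E where E: "dense_subset X E" "topological_density X = |E|"
    using topological_density_attained by blast
  then have "closedin X E"
    using assms closedin_Hausdorff_finite finite_subset by (metis dense_subset_def)
  then have "E = topspace X" using E(1) by (metis closure_of_closedin dense_subset_def)
  have "topology_base X ((\<lambda>x. {x}) ` topspace X)"
    unfolding topology_base_iff
  proof (intro conjI ballI allI impI)
    fix B assume "B \<in> (\<lambda>x. {x}) ` topspace X"
    then have "B \<subseteq> topspace X" by auto
    moreover have "closedin X (topspace X - B)"
      using assms by (intro closedin_Hausdorff_finite) auto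
    ultimately show "openin X B" by (simp add: openin_closedin)
  next
    fix U x assume "openin X U \<and> x \<in> U"
    then show "\<exists>B\<in>(\<lambda>x. {x}) ` topspace X. x \<in> B \<and> B \<subseteq> U"
      using openin_subset by fastforce
  qed
  then have "topological_weight X \<le>o |(\<lambda>x. {x}) ` topspace X|" by (rule topological_weight_le)
  also have "|(\<lambda>x. {x}) ` topspace X| \<le>o |topspace X|" by (rule card_of_image)
  finally show ?thesis using E \<open>E = topspace X\<close> by simp
qed

section \<open>Separating boxes in a compact space\<close>

text \<open>The first sides of the boxes form a subbase: for \<open>x\<close> in an open set \<open>U\<close>, compactness covers the
  complement of \<open>U\<close> by finitely many second sides of boxes whose first side contains \<open>x\<close>, and the
  intersection of these first sides is then contained in \<open>U\<close>.\<close>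

lemma weight_le_separating_boxes:
  fixes T :: "('a set \<times> 'a set) set"
  assumes X: "compact_space X" and T: "infinite T"
    and open_T: "\<And>W. W \<in> T \<Longrightarrow> openin X (fst W) \<and> openin X (snd W) \<and> fst W \<inter> snd W = {}"
    and sep: "\<And>x y. x \<in> topspace X \<Longrightarrow> y \<in> topspace X \<Longrightarrow> x \<noteq> y \<Longrightarrow> \<exists>W\<in>T. x \<in> fst W \<and> y \<in> snd W"
  shows "topological_weight X \<le>o |T|"
proof -
  define b where "b F = topspace X \<inter> \<Inter>(fst ` F)" for F :: "('a set \<times> 'a set) set"
  have "topology_base X (b ` Fpow T)"
    unfolding topology_base_iff
  proof (intro conjI ballI allI impI)
    fix B assume "B \<in> b ` Fpow T"
    then obtain F where F: "finite F" "F \<subseteq> T" "B = b F" by (auto simp: Fpow_def)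
    show "openin X B"
      unfolding F(3) b_def using F(1,2) open_T
      by (cases "F = {}") (auto intro!: openin_Int openin_Inter)
  next
    fix U x assume U: "openin X U \<and> x \<in> U"
    then have x: "x \<in> topspace X" using openin_subset by blast
    have "closedin X (topspace X - U)" using U by blast
    then have "compactin X (topspace X - U)" by (rule closedin_compact_space[OF X])
    moreover have "topspace X - U \<subseteq> \<Union>(snd ` {W \<in> T. x \<in> fst W})"
      using sep[OF x] U by fastforce
    ultimately obtain \<V> where V: "finite \<V>" "\<V> \<subseteq> snd ` {W \<in> T. x \<in> fst W}" "topspace X - U \<subseteq> \<Union>\<V>"
      using open_T compactinD[of X "topspace X - U" "snd ` {W \<in> T. x \<in> fst W}"] by blast
    then obtain F where F: "F \<subseteq> {W \<in> T. x \<in> fst W}" "finite F" "\<V> = snd ` F"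
      by (meson finite_subset_image)
    have "b F \<subseteq> U"
    proof
      fix z assume z: "z \<in> b F"
      show "z \<in> U"
      proof (rule ccontr)
        assume "z \<notin> U"
        then obtain W where "W \<in> F" "z \<in> snd W" using z V(3) F(3) unfolding b_def by auto
        then show False using z F(1) open_T[of W] unfolding b_def by auto
      qed
    qed
    moreover have "x \<in> b F" "b F \<in> b ` Fpow T" using x F unfolding b_def Fpow_def by auto
    ultimately show "\<exists>B\<in>b ` Fpow T. x \<in> B \<and> B \<subseteq> U" by blast
  qed
  then have "topological_weight X \<le>o |b ` Fpow T|" by (rule topological_weight_le)
  also have "|b ` Fpow T| \<le>o |Fpow T|" by (rule card_of_image)
  also have "|Fpow T| \<le>o |T|" by (rule card_of_Fpow_ordLeq_infinite[OF T])
  finally show ?thesis .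
qed

text \<open>A point is determined by the boxes whose first side contains it.\<close>

lemma finite_separating_boxes_imp_finite:
  assumes "finite T" and disj: "\<And>W. W \<in> T \<Longrightarrow> fst W \<inter> snd W = {}"
    and sep: "\<And>x y. x \<in> S \<Longrightarrow> y \<in> S \<Longrightarrow> x \<noteq> y \<Longrightarrow> \<exists>W\<in>T. x \<in> fst W \<and> y \<in> snd W"
  shows "finite S"
proof -
  have "inj_on (\<lambda>x. {W \<in> T. x \<in> fst W}) S"
  proof (rule inj_onI, rule ccontr)
    fix x y assume xy: "x \<in> S" "y \<in> S" "{W \<in> T. x \<in> fst W} = {W \<in> T. y \<in> fst W}" "x \<noteq> y"
    from sep[OF xy(1,2,4)] obtain W where "W \<in> T" "x \<in> fst W" "y \<in> snd W" by blast
    then show False using xy(3) disj by blast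
  qed
  moreover have "(\<lambda>x. {W \<in> T. x \<in> fst W}) ` S \<subseteq> Pow T" by auto
  ultimately show ?thesis using \<open>finite T\<close> by (meson finite_Pow_iff inj_on_finite)
qed

text \<open>Well-order all boxes and keep those with a fresh pair, one that lies in no earlier box. The kept
  boxes still cover, because every pair is fresh in the first box that contains it; this is why there
  are as many of them as the weight. The condition is recorded in the symmetric
  form in which it is used, where the order of the two boxes no longer matters.\<close>

lemma exists_right_separated_boxes:
  assumes X: "compact_space X" "Hausdorff_space X" "infinite (topspace X)"
  obtains T and x y :: "'a set \<times> 'a set \<Rightarrow> 'a"
  where "infinite T" "topological_weight X \<le>o |T|"
    and "\<And>W. W \<in> T \<Longrightarrow> openin X (fst W) \<and> openin X (snd W) \<and> x W \<in> fst W \<and> y W \<in> snd W"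
    and "\<And>W W'. W \<in> T \<Longrightarrow> W' \<in> T \<Longrightarrow> x W \<in> fst W' \<Longrightarrow> y W \<in> snd W' \<Longrightarrow>
           x W' \<in> fst W \<Longrightarrow> y W' \<in> snd W \<Longrightarrow> W = W'"
proof -
  define \<W> where "\<W> = {W. openin X (fst W) \<and> openin X (snd W) \<and> fst W \<inter> snd W = {}}"
  obtain r :: "('a set \<times> 'a set) rel" where r: "well_order r"
    using well_order_on by blast
  then have wf: "wf (r - Id)" and tot: "total r"
    by (auto simp: well_order_on_def linear_order_on_def)
  define fresh where
    "fresh W v \<longleftrightarrow> v \<in> fst W \<times> snd W \<and> (\<forall>W'\<in>\<W>. (W', W) \<in> r - Id \<longrightarrow> v \<notin> fst W' \<times> snd W')" for W v
  define T where "T = {W \<in> \<W>. \<exists>v. fresh W v}"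
  define v where "v W = (SOME v. fresh W v)" for W
  have v: "fresh W (v W)" if "W \<in> T" for W
    using that unfolding T_def v_def by (auto intro: someI_ex)
  have sep: "\<exists>W\<in>T. a \<in> fst W \<and> b \<in> snd W"
    if ab: "a \<in> topspace X" "b \<in> topspace X" "a \<noteq> b" for a b
  proof -
    obtain U V where "openin X U" "openin X V" "a \<in> U" "b \<in> V" "disjnt U V"
      using X(2) ab unfolding Hausdorff_space_def by metis
    then have "(U, V) \<in> {W \<in> \<W>. (a, b) \<in> fst W \<times> snd W}"
      by (auto simp: \<W>_def disjnt_def)
    then obtain W where W: "W \<in> \<W>" "(a, b) \<in> fst W \<times> snd W"
      and "\<And>W'. (W', W) \<in> r - Id \<Longrightarrow> W' \<notin> {W \<in> \<W>. (a, b) \<in> fst W \<times> snd W}"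
      by (rule wfE_min[OF wf]) blast
    then have "fresh W (a, b)" unfolding fresh_def by blast
    then have "W \<in> T" using W unfolding T_def by blast
    then show ?thesis using W by auto
  qed
  have disj: "openin X (fst W) \<and> openin X (snd W) \<and> fst W \<inter> snd W = {}" if "W \<in> T" for W
    using that unfolding T_def \<W>_def by blast
  have inf: "infinite T"
    using finite_separating_boxes_imp_finite[of T "topspace X"] disj sep X(3) by blast
  show ?thesis
  proof (rule that[of T "\<lambda>W. fst (v W)" "\<lambda>W. snd (v W)"])
    show "infinite T" by (rule inf)
    show "topological_weight X \<le>o |T|"
      by (rule weight_le_separating_boxes[OF X(1) inf disj sep])
    show "openin X (fst W) \<and> openin X (snd W) \<and> fst (v W) \<in> fst W \<and> snd (v W) \<in> snd W"
      if "W \<in> T" for W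
      using disj[OF that] v[OF that] by (auto simp: fresh_def mem_Times_iff)
    fix W W'
    assume W: "W \<in> T" "W' \<in> T" "fst (v W) \<in> fst W'" "snd (v W) \<in> snd W'"
      "fst (v W') \<in> fst W" "snd (v W') \<in> snd W"
    show "W = W'"
    proof (rule ccontr)
      assume "W \<noteq> W'"
      then consider "(W, W') \<in> r - Id" | "(W', W) \<in> r - Id"
        using tot unfolding total_on_def by blast
      then show False
        using v[OF W(1)] v[OF W(2)] W unfolding fresh_def T_def by cases (auto simp: mem_Times_iff)
    qed
  qed
qed

section \<open>Counting separated boxes by finite tests\<close>

text \<open>Think of \<open>g z\<close> as the set of tests that \<open>z\<close> passes. The finitely many tests \<open>N W\<close> tell,
  within \<open>C\<close>, the points over \<open>x W\<close> from those that \<open>f\<close> sends outside \<open>fst W\<close>, and the points over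
  \<open>y W\<close> from those that it sends outside \<open>snd W\<close>; and on \<open>C\<close> only tests in \<open>L\<close> are ever passed. So a
  box is determined by finite data over \<open>L\<close>:
  its relevant tests and the patterns of answers that occur over \<open>x W\<close> and over \<open>y W\<close>.\<close>

lemma separated_boxes_le_tests:
  fixes g :: "'z \<Rightarrow> 'b set" and f :: "'z \<Rightarrow> 'a"
  assumes T: "infinite T"
    and onto: "\<And>W. W \<in> T \<Longrightarrow> x W \<in> f ` C \<and> y W \<in> f ` C"
    and N: "\<And>W. W \<in> T \<Longrightarrow> finite (N W)"
    and test_x: "\<And>W z z'. W \<in> T \<Longrightarrow> z \<in> C \<Longrightarrow> z' \<in> C \<Longrightarrow> f z = x W \<Longrightarrow> f z' \<notin> fst W \<Longrightarrow>
                   N W \<inter> g z \<noteq> N W \<inter> g z'"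
    and test_y: "\<And>W z z'. W \<in> T \<Longrightarrow> z \<in> C \<Longrightarrow> z' \<in> C \<Longrightarrow> f z = y W \<Longrightarrow> f z' \<notin> snd W \<Longrightarrow>
                   N W \<inter> g z \<noteq> N W \<inter> g z'"
    and L: "\<And>W z. W \<in> T \<Longrightarrow> z \<in> C \<Longrightarrow> N W \<inter> g z \<subseteq> L"
    and cross: "\<And>W W'. W \<in> T \<Longrightarrow> W' \<in> T \<Longrightarrow> x W \<in> fst W' \<Longrightarrow> y W \<in> snd W' \<Longrightarrow>
                  x W' \<in> fst W \<Longrightarrow> y W' \<in> snd W \<Longrightarrow> W = W'"
  shows "infinite L \<and> |T| \<le>o |L|"
proof -
  define pat where "pat W u = (\<lambda>z. N W \<inter> g z) ` {z \<in> C. f z = u}" for W u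
  define code where "code W = (N W \<inter> L, pat W (x W), pat W (y W))" for W
  let ?B = "Fpow L \<times> Fpow (Fpow L) \<times> Fpow (Fpow L)"
  have pat: "pat W u \<in> Fpow (Fpow L)" if "W \<in> T" for W u
  proof -
    have "pat W u \<subseteq> Pow (N W)" unfolding pat_def by auto
    then have "finite (pat W u)" using N[OF that] by (simp add: finite_subset)
    then show ?thesis using N[OF that] L[OF that] unfolding pat_def Fpow_def by auto
  qed
  have code: "code ` T \<subseteq> ?B"
    using pat N unfolding code_def Fpow_def[of L] by blast
  \<comment> \<open>If the patterns over \<open>u'\<close> also occur over \<open>u\<close>, then no test of \<open>W\<close> tells \<open>u'\<close> from \<open>u\<close>, so
     \<open>u'\<close> lies in the neighbourhood \<open>S\<close> of \<open>u\<close> that these tests detect.\<close>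
  have caught: "u' \<in> S"
    if "W \<in> T" "W' \<in> T" "N W \<inter> L = N W' \<inter> L" "pat W u = pat W' u'" "u' \<in> f ` C"
      and test: "\<And>z z'. z \<in> C \<Longrightarrow> z' \<in> C \<Longrightarrow> f z = u \<Longrightarrow> f z' \<notin> S \<Longrightarrow> N W \<inter> g z \<noteq> N W \<inter> g z'"
    for W W' u u' S
  proof (rule ccontr)
    assume "u' \<notin> S"
    obtain z' where z': "z' \<in> C" "f z' = u'" using \<open>u' \<in> f ` C\<close> by blast
    then have "N W' \<inter> g z' \<in> pat W' u'" unfolding pat_def by blast
    then have "N W' \<inter> g z' \<in> pat W u" using that(4) by simp
    then obtain z where z: "z \<in> C" "f z = u" "N W \<inter> g z = N W' \<inter> g z'"
      unfolding pat_def by auto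
    have "N W' \<inter> g z' = N W \<inter> g z'" using L[of W z'] L[of W' z'] that z' by blast
    then show False using test[of z z'] z z' \<open>u' \<notin> S\<close> by simp
  qed
  have "inj_on code T"
  proof (rule inj_onI)
    fix W W' assume W: "W \<in> T" "W' \<in> T" "code W = code W'"
    then have eq: "N W \<inter> L = N W' \<inter> L" "pat W (x W) = pat W' (x W')" "pat W (y W) = pat W' (y W')"
      unfolding code_def by auto
    show "W = W'"
    proof (rule cross[OF W(1,2)])
      show "x W' \<in> fst W" by (rule caught[OF W(1,2) eq(1,2)]) (use onto test_x W in blast)+
      show "y W' \<in> snd W" by (rule caught[OF W(1,2) eq(1,3)]) (use onto test_y W in blast)+
      show "x W \<in> fst W'"
        by (rule caught[OF W(2,1) eq(1,2)[symmetric]]) (use onto test_x W in blast)+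
      show "y W \<in> snd W'"
        by (rule caught[OF W(2,1) eq(1,3)[symmetric]]) (use onto test_y W in blast)+
    qed
  qed
  then have TB: "|T| \<le>o |?B|" using code card_of_ordLeq by blast
  have "infinite L"
  proof
    assume "finite L"
    then have "finite ?B" by (simp add: finite_Fpow)
    then show False using TB T card_of_ordLeq_finite by blast
  qed
  moreover from this have FL: "|Fpow L| \<le>o |L|" by (rule card_of_Fpow_ordLeq_infinite)
  have FFL: "|Fpow (Fpow L)| \<le>o |L|"
    using card_of_Fpow_ordLeq_infinite[OF infinite_Fpow] \<open>infinite L\<close> FL ordLeq_transitive by blast
  have "|Fpow (Fpow L) \<times> Fpow (Fpow L)| \<le>o |L|"
    using \<open>infinite L\<close> FFL by (intro card_of_Sigma_ordLeq_infinite) auto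
  then have "|?B| \<le>o |L|"
    using \<open>infinite L\<close> FL by (intro card_of_Sigma_ordLeq_infinite) auto
  ultimately show ?thesis using TB ordLeq_transitive by blast
qed

section \<open>Powers of the one-point compactification of a discrete space\<close>

abbreviation Alexandroff_power :: "'m set \<Rightarrow> 'k set \<Rightarrow> ('k \<Rightarrow> 'm option) topology" where
  "Alexandroff_power M K \<equiv>
     product_topology (\<lambda>_. Alexandroff_compactification (discrete_topology M)) K"

lemma topspace_Alexandroff_power:
  "topspace (Alexandroff_power M K) = (\<Pi>\<^sub>E j\<in>K. insert None (Some ` M))"
  by simp

lemma compact_space_Alexandroff_power: "compact_space (Alexandroff_power M K)"
  by (simp add: compact_space_product_topology)

text \<open>The points \<open>Some m\<close> are isolated. A test ``\<open>z j = Some m\<close>'' is written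
  \<open>(j, m) \<in> Map.graph z\<close>, so that the answers to a set \<open>N\<close> of tests are the set
  \<open>N \<inter> Map.graph z\<close>.\<close>

lemma clopen_graph_test:
  assumes "j \<in> K" "m \<in> M"
  shows "openin (Alexandroff_power M K) {z \<in> topspace (Alexandroff_power M K). (j, m) \<in> Map.graph z}"
    and "closedin (Alexandroff_power M K) {z \<in> topspace (Alexandroff_power M K). (j, m) \<in> Map.graph z}"
proof -
  let ?A = "Alexandroff_compactification (discrete_topology M)"
  have cont: "continuous_map (Alexandroff_power M K) ?A (\<lambda>z. z j)"
    using assms(1) by (rule continuous_map_product_projection)
  have eq: "{z \<in> topspace (Alexandroff_power M K). (j, m) \<in> Map.graph z} =
      {z \<in> topspace (Alexandroff_power M K). z j \<in> Some ` {m}}"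
    by (auto simp: Map.graph_def)
  show "openin (Alexandroff_power M K) {z \<in> topspace (Alexandroff_power M K). (j, m) \<in> Map.graph z}"
    unfolding eq by (rule openin_continuous_map_preimage[OF cont])
      (use assms in \<open>simp only: openin_Alexandroff_compactification_image_Some, simp\<close>)
  show "closedin (Alexandroff_power M K) {z \<in> topspace (Alexandroff_power M K). (j, m) \<in> Map.graph z}"
    unfolding eq by (rule closedin_continuous_map_preimage[OF cont])
      (use assms in \<open>simp only: closedin_Alexandroff_compactification_image_Some, simp\<close>)
qed

text \<open>Different points differ in some test, and the pairs that differ in a given test form an open
  subset of the square of the space; the product of the two closed sets is compact.\<close>

lemma finite_tests_separate_closed:
  assumes A: "closedin (Alexandroff_power M K) A" and B: "closedin (Alexandroff_power M K) B"
    and disj: "A \<inter> B = {}"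
  obtains N where "finite N" "N \<subseteq> K \<times> M"
    "\<And>z z'. z \<in> A \<Longrightarrow> z' \<in> B \<Longrightarrow> N \<inter> Map.graph z \<noteq> N \<inter> Map.graph z'"
proof -
  let ?Z = "Alexandroff_power M K"
  define G where "G t = {z \<in> topspace ?Z. t \<in> Map.graph z}" for t
  define H where "H t = G t \<times> (topspace ?Z - G t) \<union> (topspace ?Z - G t) \<times> G t" for t
  have open_H: "openin (prod_topology ?Z ?Z) (H t)" if "t \<in> K \<times> M" for t
  proof -
    have "openin ?Z (G t)" "openin ?Z (topspace ?Z - G t)"
      using that clopen_graph_test[of "fst t" K "snd t" M]
      unfolding G_def by (auto simp del: topspace_product_topology)
    then show ?thesis unfolding H_def by (intro openin_Un) (auto simp: openin_prod_Times_iff)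
  qed
  have sub: "A \<subseteq> topspace ?Z" "B \<subseteq> topspace ?Z"
    using A B closedin_subset by blast+
  have cover: "A \<times> B \<subseteq> \<Union>(H ` (K \<times> M))"
  proof clarify
    fix z z' assume z: "z \<in> A" "z' \<in> B"
    then have zz': "z \<in> topspace ?Z" "z' \<in> topspace ?Z" "z \<noteq> z'" using sub disj by auto
    then obtain j where j: "j \<in> K" "z j \<noteq> z' j"
      unfolding topspace_Alexandroff_power by (meson PiE_ext)
    have "z j \<in> insert None (Some ` M)" "z' j \<in> insert None (Some ` M)"
      using zz' j(1) unfolding topspace_Alexandroff_power by (auto simp: PiE_iff)
    with j(2) obtain m where "m \<in> M" "(z j = Some m) \<noteq> (z' j = Some m)" by auto
    then have "(z, z') \<in> H (j, m)" using zz' by (auto simp: H_def G_def Map.graph_def)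
    then show "(z, z') \<in> \<Union>(H ` (K \<times> M))" using j \<open>m \<in> M\<close> by blast
  qed
  have "compactin ?Z A" "compactin ?Z B"
    using A B compact_space_Alexandroff_power by (auto intro: closedin_compact_space)
  then have "compactin (prod_topology ?Z ?Z) (A \<times> B)" by (simp add: compactin_Times)
  then obtain \<F> where F: "finite \<F>" "\<F> \<subseteq> H ` (K \<times> M)" "A \<times> B \<subseteq> \<Union>\<F>"
    using compactinD[OF _ _ cover] open_H by (smt (verit) imageE)
  then obtain N where N: "N \<subseteq> K \<times> M" "finite N" "\<F> = H ` N"
    by (meson finite_subset_image)
  show ?thesis
  proof (rule that[OF N(2,1)])
    fix z z' assume "z \<in> A" "z' \<in> B"
    then obtain t where "t \<in> N" "(z, z') \<in> H t" using F(3) N(3) by blast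
    then show "N \<inter> Map.graph z \<noteq> N \<inter> Map.graph z'" unfolding H_def G_def by blast
  qed
qed

text \<open>The point and the finite set come as a pair so that a set of truncations is an image under
  \<open>truncate J\<close> and can be counted by pairs.\<close>

definition truncate :: "'k set \<Rightarrow> ('k \<Rightarrow> 'm option) \<times> 'k set \<Rightarrow> 'k \<Rightarrow> 'm option" where
  "truncate J = (\<lambda>(p, F) j. if j \<in> J - F then None else p j)"

lemma truncate_in_Alexandroff_power:
  assumes "p \<in> topspace (Alexandroff_power M K)" "J \<subseteq> K"
  shows "truncate J (p, F) \<in> topspace (Alexandroff_power M K)"
  using assms unfolding topspace_Alexandroff_power truncate_def
  by (auto simp: PiE_iff extensional_def)

text \<open>A basic neighbourhood of \<open>p\<close> restricts finitely many coordinates, and it suffices to keep \<open>p\<close>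
  on these.\<close>

lemma in_closure_of_truncations:
  assumes p: "p \<in> topspace (Alexandroff_power M K)" and J: "J \<subseteq> K"
  shows "p \<in> Alexandroff_power M K closure_of (\<lambda>F. truncate J (p, F)) ` Fpow J"
  unfolding in_closure_of
proof (intro conjI allI impI p)
  fix O' assume O: "p \<in> O' \<and> openin (Alexandroff_power M K) O'"
  let ?A = "Alexandroff_compactification (discrete_topology M)"
  obtain U where U: "finite {j \<in> K. U j \<noteq> topspace ?A}" "p \<in> Pi\<^sub>E K U" "Pi\<^sub>E K U \<subseteq> O'"
    using O unfolding openin_product_topology_alt by blast
  let ?F = "{j \<in> K. U j \<noteq> topspace ?A} \<inter> J"
  have "truncate J (p, ?F) \<in> Pi\<^sub>E K U"
  proof (rule PiE_I)
    fix j assume "j \<in> K"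
    then show "truncate J (p, ?F) j \<in> U j"
      using U(2) by (cases "U j = topspace ?A") (auto simp: truncate_def PiE_iff)
  next
    fix j assume "j \<notin> K"
    then show "truncate J (p, ?F) j = undefined"
      using U(2) J by (auto simp: truncate_def PiE_iff extensional_def)
  qed
  moreover have "?F \<in> Fpow J" using U(1) by (simp add: Fpow_def)
  ultimately show "\<exists>y. y \<in> (\<lambda>F. truncate J (p, F)) ` Fpow J \<and> y \<in> O'" using U(3) by blast
qed

section \<open>Dense subspaces of prescribed density\<close>

text \<open>The lower bound for the density. Every truncation indexed by \<open>R\<close> passes only finitely many tests
  with coordinate in \<open>J\<close>. A test is an open condition, so one that fails on all these truncations
  fails on their closure \<open>C\<close>; hence the tests that matter on \<open>C\<close> number finitely many per element of
  \<open>R\<close>. Density makes \<open>f\<close> map the compact set \<open>C\<close> onto \<open>X\<close>, and the boxes can be counted by tests.\<close>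

lemma card_le_dense_truncations:
  fixes X :: "'a topology" and f :: "('k \<Rightarrow> 'm option) \<Rightarrow> 'a" and M :: "'m set" and K :: "'k set"
  defines "Z \<equiv> Alexandroff_power M K"
  assumes X: "Hausdorff_space X" and f: "continuous_map Z X f"
    and T: "infinite T"
    and pts: "\<And>W. W \<in> T \<Longrightarrow> x W \<in> topspace X \<and> y W \<in> topspace X"
    and N: "\<And>W. W \<in> T \<Longrightarrow> finite (N W) \<and> N W \<subseteq> J \<times> M"
    and J: "J \<subseteq> K"
    and test_x: "\<And>W z z'. W \<in> T \<Longrightarrow> z \<in> topspace Z \<Longrightarrow> z' \<in> topspace Z \<Longrightarrow> f z = x W \<Longrightarrow>
                   f z' \<notin> fst W \<Longrightarrow> N W \<inter> Map.graph z \<noteq> N W \<inter> Map.graph z'"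
    and test_y: "\<And>W z z'. W \<in> T \<Longrightarrow> z \<in> topspace Z \<Longrightarrow> z' \<in> topspace Z \<Longrightarrow> f z = y W \<Longrightarrow>
                   f z' \<notin> snd W \<Longrightarrow> N W \<inter> Map.graph z \<noteq> N W \<inter> Map.graph z'"
    and cross: "\<And>W W'. W \<in> T \<Longrightarrow> W' \<in> T \<Longrightarrow> x W \<in> fst W' \<Longrightarrow> y W \<in> snd W' \<Longrightarrow>
                  x W' \<in> fst W \<Longrightarrow> y W' \<in> snd W \<Longrightarrow> W = W'"
    and R: "R \<subseteq> topspace Z \<times> Fpow J"
    and dense: "dense_subset X (f ` truncate J ` R)"
  shows "|T| \<le>o |R|"
proof -
  define C where "C = Z closure_of (truncate J ` R)"
  define L where "L = (\<Union>(p, F)\<in>R. Map.graph p \<inter> F \<times> UNIV)"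
  have Q: "truncate J ` R \<subseteq> topspace Z"
  proof (rule image_subsetI)
    fix r assume "r \<in> R"
    then have "fst r \<in> topspace Z" using R by auto
    then show "truncate J r \<in> topspace Z"
      using truncate_in_Alexandroff_power[OF _ J, of "fst r" M "snd r"] unfolding Z_def by simp
  qed
  have C: "C \<subseteq> topspace Z" unfolding C_def by (rule closure_of_subset_topspace)
  have onto: "f ` C = topspace X"
  proof -
    have "compactin Z C" unfolding C_def Z_def
      by (rule closedin_compact_space[OF compact_space_Alexandroff_power closedin_closure_of])
    then have "closedin X (f ` C)"
      using image_compactin[OF _ f] compactin_imp_closedin[OF X] by blast
    moreover have "f ` truncate J ` R \<subseteq> f ` C"
      unfolding C_def by (rule image_mono[OF closure_of_subset[OF Q]])
    ultimately have "X closure_of (f ` truncate J ` R) \<subseteq> f ` C" by (simp add: closure_of_minimal)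
    then show ?thesis
      using dense C continuous_map_image_subset_topspace[OF f] unfolding dense_subset_def by blast
  qed
  have LC: "N W \<inter> Map.graph z \<subseteq> L" if W: "W \<in> T" and z: "z \<in> C" for W z
  proof
    fix t assume t: "t \<in> N W \<inter> Map.graph z"
    obtain j m where jm: "t = (j, m)" "j \<in> J" "m \<in> M" using N[OF W] t by blast
    then have "openin Z {z \<in> topspace Z. t \<in> Map.graph z}"
      using J clopen_graph_test(1)[of j K m M] unfolding Z_def by blast
    moreover have "z \<in> {z \<in> topspace Z. t \<in> Map.graph z}" using t z C by auto
    ultimately obtain q where q: "q \<in> truncate J ` R" "t \<in> Map.graph q"
      using z[unfolded C_def in_closure_of] by (metis (no_types, lifting) mem_Collect_eq)
    then obtain p F where pF: "(p, F) \<in> R" "q = truncate J (p, F)" by auto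
    then have "t \<in> Map.graph p \<inter> F \<times> UNIV"
      using q(2) jm by (auto simp: truncate_def Map.graph_def split: if_splits)
    then show "t \<in> L" unfolding L_def using pF by blast
  qed
  have TL: "infinite L \<and> |T| \<le>o |L|"
  proof (rule separated_boxes_le_tests[where f = f and g = Map.graph and C = C and N = N and x = x and y = y])
    show "x W \<in> f ` C \<and> y W \<in> f ` C" if "W \<in> T" for W
      using pts[OF that] onto by simp
  qed (use T N test_x test_y C LC cross in \<open>blast+\<close>)
  have fin: "finite (case r of (p, F) \<Rightarrow> Map.graph p \<inter> F \<times> UNIV)" if "r \<in> R" for r
  proof (cases r)
    case (Pair p F)
    then have "finite F" using that R by (auto simp: Fpow_def)
    moreover have "Map.graph p \<inter> F \<times> UNIV \<subseteq> (\<lambda>j. (j, the (p j))) ` F"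
      by (auto simp: Map.graph_def)
    ultimately have "finite (Map.graph p \<inter> F \<times> UNIV)" using finite_surj by blast
    then show ?thesis by (simp add: Pair)
  qed
  have inf: "infinite R"
  proof
    assume "finite R"
    then have "finite L" unfolding L_def using fin by (rule finite_UN_I)
    then show False using TL by blast
  qed
  have "|L| \<le>o |R|"
    unfolding L_def using inf fin
    by (intro card_of_UNION_ordLeq_infinite) (auto intro: card_of_finite_ordLeq_infinite card_of_mono1)
  then show ?thesis using TL ordLeq_transitive by blast
qed

text \<open>The subspace consists of the images of the truncations, to finite parts of \<open>J\<close>, of a lifted
  dense set \<open>P\<close>. The bound \<open>d(X) \<le> \<nu>\<close> controls the size of \<open>P\<close>, and \<open>\<nu> \<le> w(X)\<close> provides the \<open>\<nu>\<close>
  separated boxes that keep the density from dropping below \<open>\<nu>\<close>.\<close>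

lemma exists_dense_subspace_of_density:
  fixes X :: "'a topology" and f :: "('k \<Rightarrow> 'm option) \<Rightarrow> 'a" and \<nu> :: "'l rel"
  assumes X: "compact_space X" "Hausdorff_space X" "infinite (topspace X)"
    and f: "continuous_map (Alexandroff_power M K) X f"
    and onto: "f ` topspace (Alexandroff_power M K) = topspace X"
    and \<nu>: "Card_order \<nu>" "topological_density X \<le>o \<nu>" "\<nu> \<le>o topological_weight X"
  obtains D where "dense_subset X D" "topological_density (subtopology X D) =o \<nu>"
proof -
  let ?Z = "Alexandroff_power M K"
  obtain T0 and x y :: "'a set \<times> 'a set \<Rightarrow> 'a" where T0: "topological_weight X \<le>o |T0|"
    and box0: "\<And>W. W \<in> T0 \<Longrightarrow> openin X (fst W) \<and> openin X (snd W) \<and> x W \<in> fst W \<and> y W \<in> snd W"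
    and cross0: "\<And>W W'. W \<in> T0 \<Longrightarrow> W' \<in> T0 \<Longrightarrow> x W \<in> fst W' \<Longrightarrow> y W \<in> snd W' \<Longrightarrow>
           x W' \<in> fst W \<Longrightarrow> y W' \<in> snd W \<Longrightarrow> W = W'"
    using exists_right_separated_boxes[OF X] by metis
  have "|Field \<nu>| =o \<nu>" by (rule card_of_Field_ordIso[OF \<nu>(1)])
  then have "|Field \<nu>| \<le>o |T0|"
    using \<nu>(3) T0 by (meson ordIso_ordLeq_trans ordLeq_transitive)
  then obtain T where T: "T \<subseteq> T0" "|Field \<nu>| =o |T|"
    unfolding internalize_card_of_ordLeq2[of "Field \<nu>" T0] by blast
  then have T_nu: "|T| =o \<nu>"
    using \<open>|Field \<nu>| =o \<nu>\<close> ordIso_symmetric ordIso_transitive by blast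
  obtain E where E: "dense_subset X E" "topological_density X = |E|"
    using topological_density_attained by blast
  have "infinite E"
  proof
    assume "finite E"
    then have "closedin X E"
      using X(2) E(1) closedin_Hausdorff_finite by (metis dense_subset_def)
    then have "E = topspace X" using E(1) by (metis closure_of_closedin dense_subset_def)
    then show False using \<open>finite E\<close> X(3) by simp
  qed
  have ET: "|E| \<le>o |T|"
    using \<nu>(2) E(2) T_nu by (metis ordIso_symmetric ordLeq_ordIso_trans)
  then have T_inf: "infinite T" using \<open>infinite E\<close> card_of_ordLeq_infinite by blast

  \<comment> \<open>The tests are chosen on all of \<open>Z\<close>, before any small set of truncations is given: \<open>J\<close>, and
     hence \<open>D\<close>, depends on them.\<close>
  have "\<forall>W\<in>T. \<exists>N. finite N \<and> N \<subseteq> K \<times> M \<and>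
      (\<forall>z\<in>topspace ?Z. \<forall>z'\<in>topspace ?Z.
         (f z = x W \<and> f z' \<notin> fst W \<or> f z = y W \<and> f z' \<notin> snd W) \<longrightarrow>
           N \<inter> Map.graph z \<noteq> N \<inter> Map.graph z')"
  proof
    fix W assume W: "W \<in> T"
    have *: "\<exists>N. finite N \<and> N \<subseteq> K \<times> M \<and>
      (\<forall>z\<in>topspace ?Z. \<forall>z'\<in>topspace ?Z. f z = u \<and> f z' \<notin> U \<longrightarrow>
           N \<inter> Map.graph z \<noteq> N \<inter> Map.graph z')" if "openin X U" "u \<in> U" for u U
    proof -
      have u: "u \<in> topspace X" using that openin_subset by blast
      have "closedin ?Z {z \<in> topspace ?Z. f z \<in> {u}}"
        using u closedin_Hausdorff_sing_eq[OF X(2)] by (intro closedin_continuous_map_preimage[OF f]) simp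
      moreover have "closedin ?Z {z \<in> topspace ?Z. f z \<in> topspace X - U}"
        using that by (intro closedin_continuous_map_preimage[OF f]) auto
      moreover have "{z \<in> topspace ?Z. f z \<in> {u}} \<inter> {z \<in> topspace ?Z. f z \<in> topspace X - U} = {}"
        using that by auto
      ultimately obtain N where N: "finite N" "N \<subseteq> K \<times> M"
        "\<And>z z'. z \<in> {z \<in> topspace ?Z. f z \<in> {u}} \<Longrightarrow> z' \<in> {z \<in> topspace ?Z. f z \<in> topspace X - U} \<Longrightarrow>
           N \<inter> Map.graph z \<noteq> N \<inter> Map.graph z'"
        by (rule finite_tests_separate_closed) blast
      moreover have "f z' \<in> topspace X" if "z' \<in> topspace ?Z" for z' using that onto by blast
      ultimately show ?thesis by (intro exI[of _ N]) blast
    qed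
    have W': "openin X (fst W)" "x W \<in> fst W" "openin X (snd W)" "y W \<in> snd W"
      using box0 W T(1) by blast+
    obtain N1 where "finite N1 \<and> N1 \<subseteq> K \<times> M \<and>
      (\<forall>z\<in>topspace ?Z. \<forall>z'\<in>topspace ?Z. f z = x W \<and> f z' \<notin> fst W \<longrightarrow>
           N1 \<inter> Map.graph z \<noteq> N1 \<inter> Map.graph z')" using *[OF W'(1,2)] by blast
    moreover obtain N2 where "finite N2 \<and> N2 \<subseteq> K \<times> M \<and>
      (\<forall>z\<in>topspace ?Z. \<forall>z'\<in>topspace ?Z. f z = y W \<and> f z' \<notin> snd W \<longrightarrow>
           N2 \<inter> Map.graph z \<noteq> N2 \<inter> Map.graph z')" using *[OF W'(3,4)] by blast
    moreover have "N1 \<inter> G = N1 \<inter> G' \<and> N2 \<inter> G = N2 \<inter> G'" if "(N1 \<union> N2) \<inter> G = (N1 \<union> N2) \<inter> G'" for G G'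
      using that by blast
    ultimately show "\<exists>N. finite N \<and> N \<subseteq> K \<times> M \<and>
      (\<forall>z\<in>topspace ?Z. \<forall>z'\<in>topspace ?Z.
         (f z = x W \<and> f z' \<notin> fst W \<or> f z = y W \<and> f z' \<notin> snd W) \<longrightarrow>
           N \<inter> Map.graph z \<noteq> N \<inter> Map.graph z')"
      by (intro exI[of _ "N1 \<union> N2"] conjI ballI impI) (blast, blast, metis)
  qed
  then obtain N where N: "\<And>W. W \<in> T \<Longrightarrow> finite (N W) \<and> N W \<subseteq> K \<times> M"
    and test: "\<And>W z z'. W \<in> T \<Longrightarrow> z \<in> topspace ?Z \<Longrightarrow> z' \<in> topspace ?Z \<Longrightarrow>
      f z = x W \<and> f z' \<notin> fst W \<or> f z = y W \<and> f z' \<notin> snd W \<Longrightarrow>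
      N W \<inter> Map.graph z \<noteq> N W \<inter> Map.graph z'"
    by metis
  define J where "J = (\<Union>W\<in>T. fst ` N W)"
  have J: "J \<subseteq> K" using N unfolding J_def by fastforce
  have "|J| \<le>o |T|"
    unfolding J_def using T_inf N
    by (intro card_of_UNION_ordLeq_infinite) (auto intro: card_of_finite_ordLeq_infinite card_of_mono1)
  have FJ: "|Fpow J| \<le>o |T|"
  proof (cases "finite J")
    case True
    then show ?thesis using T_inf by (simp add: finite_Fpow card_of_finite_ordLeq_infinite)
  next
    case False
    then show ?thesis using card_of_Fpow_ordLeq_infinite \<open>|J| \<le>o |T|\<close> ordLeq_transitive by blast
  qed

  define P where "P = inv_into (topspace ?Z) f ` E"
  have sub: "E \<subseteq> f ` topspace ?Z" using E(1) onto by (simp add: dense_subset_def)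
  have P: "P \<subseteq> topspace ?Z"
    unfolding P_def using sub inv_into_into[of _ f "topspace ?Z"] by blast
  have fP: "f ` P = E" unfolding P_def by (rule image_inv_into_cancel[OF refl sub])
  have "|P| \<le>o |T|" unfolding P_def using card_of_image ET ordLeq_transitive by blast
  then have PFJ: "|P \<times> Fpow J| \<le>o |T|"
    using FJ T_inf by (intro card_of_Sigma_ordLeq_infinite) auto
  define D where "D = f ` truncate J ` (P \<times> Fpow J)"
  have Q: "truncate J ` (P \<times> Fpow J) \<subseteq> topspace ?Z"
  proof (rule image_subsetI)
    fix r assume "r \<in> P \<times> Fpow J"
    then have "fst r \<in> P" by auto
    then have "fst r \<in> topspace ?Z" by (rule subsetD[OF P])
    then show "truncate J r \<in> topspace ?Z"
      using truncate_in_Alexandroff_power[OF _ J, of "fst r" M "snd r"] by simp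
  qed
  have D: "dense_subset X D"
  proof -
    have "P \<subseteq> ?Z closure_of truncate J ` (P \<times> Fpow J)"
    proof
      fix p assume p: "p \<in> P"
      then have "p \<in> ?Z closure_of (\<lambda>F. truncate J (p, F)) ` Fpow J"
        using P J by (intro in_closure_of_truncations) auto
      moreover have "(\<lambda>F. truncate J (p, F)) ` Fpow J \<subseteq> truncate J ` (P \<times> Fpow J)"
        using p by auto
      ultimately show "p \<in> ?Z closure_of truncate J ` (P \<times> Fpow J)"
        using closure_of_mono by blast
    qed
    then have "E \<subseteq> f ` (?Z closure_of truncate J ` (P \<times> Fpow J))" using fP by blast
    also have "\<dots> \<subseteq> X closure_of D"
      unfolding D_def by (rule continuous_map_image_closure_subset[OF f])
    finally have "X closure_of E \<subseteq> X closure_of D" by (simp add: closure_of_minimal)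
    moreover have "D \<subseteq> topspace X" unfolding D_def using Q onto by blast
    ultimately show ?thesis
      using E(1) closure_of_subset_topspace[of X D] unfolding dense_subset_def by auto
  qed
  have "topological_density (subtopology X D) \<le>o |T|"
  proof -
    have "dense_subset (subtopology X D) D"
      using D by (simp add: dense_subset_iff) (metis Int_absorb1 openin_subset topspace_subtopology_subset inf.commute)
    then have "topological_density (subtopology X D) \<le>o |D|" by (rule topological_density_le)
    also have "|D| \<le>o |truncate J ` (P \<times> Fpow J)|" unfolding D_def by (rule card_of_image)
    also have "|truncate J ` (P \<times> Fpow J)| \<le>o |P \<times> Fpow J|" by (rule card_of_image)
    also note PFJ
    finally show ?thesis .
  qed
  moreover have "|T| \<le>o topological_density (subtopology X D)"
  proof -
    obtain H where H: "dense_subset (subtopology X D) H"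
      "topological_density (subtopology X D) = |H|"
      using topological_density_attained by blast
    have "H \<subseteq> (f \<circ> truncate J) ` (P \<times> Fpow J)"
      using H(1) unfolding dense_subset_def D_def by (auto simp: image_comp)
    \<comment> \<open>One pair per point of \<open>H\<close>, so that \<open>R\<close> is no larger than \<open>H\<close>.\<close>
    then obtain R where R: "R \<subseteq> P \<times> Fpow J" "inj_on (f \<circ> truncate J) R" "H = (f \<circ> truncate J) ` R"
      by (meson subset_image_inj)
    have "dense_subset X (f ` truncate J ` R)"
      using dense_subset_trans[OF D H(1)] R(3) by (simp add: image_comp)
    moreover have "R \<subseteq> topspace ?Z \<times> Fpow J" using R(1) P by blast
    moreover have "finite (N W) \<and> N W \<subseteq> J \<times> M" if "W \<in> T" for W
      using N[OF that] that unfolding J_def by force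
    moreover have "x W \<in> topspace X \<and> y W \<in> topspace X" if "W \<in> T" for W
      using box0 that T(1) openin_subset by blast
    ultimately have "|T| \<le>o |R|"
      using card_le_dense_truncations[OF X(2) f T_inf, of x y N J R] J test cross0 T(1) by blast
    also have "|R| =o |H|"
      using R(2,3) by (metis card_of_ordIso inj_on_imp_bij_betw)
    finally show ?thesis using H(2) by simp
  qed
  ultimately have "topological_density (subtopology X D) =o |T|" by (simp add: ordIso_iff_ordLeq)
  then have "topological_density (subtopology X D) =o \<nu>" using T_nu ordIso_transitive by blast
  then show ?thesis using that D by blast
qed

lemma polyadic_dense_subspace_density_iff:
  fixes X :: "'a topology" and \<nu> :: "'l rel"
  assumes "polyadic TYPE('m) TYPE('k) X" and \<nu>: "Card_order \<nu>"
  shows "(\<exists>D. dense_subset X D \<and> topological_density (subtopology X D) =o \<nu>) \<longleftrightarrow>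
    topological_density X \<le>o \<nu> \<and> \<nu> \<le>o topological_weight X"
proof
  assume "\<exists>D. dense_subset X D \<and> topological_density (subtopology X D) =o \<nu>"
  then obtain D where D: "dense_subset X D" "topological_density (subtopology X D) =o \<nu>" by blast
  then have "D \<subseteq> topspace X" by (simp add: dense_subset_def)
  then show "topological_density X \<le>o \<nu> \<and> \<nu> \<le>o topological_weight X"
    using D topological_density_dense_subspace_ge topological_density_subspace_le_weight
    by (meson ordIso_ordLeq_trans ordIso_symmetric ordLeq_ordIso_trans)
next
  assume le: "topological_density X \<le>o \<nu> \<and> \<nu> \<le>o topological_weight X"
  obtain M :: "'m set" and K :: "'k set" and f where X: "compact_space X" "Hausdorff_space X"
    and f: "continuous_map (Alexandroff_power M K) X f"
      "f ` topspace (Alexandroff_power M K) = topspace X"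
    using assms(1) unfolding polyadic_def adic_def by blast
  show "\<exists>D. dense_subset X D \<and> topological_density (subtopology X D) =o \<nu>"
  proof (cases "finite (topspace X)")
    case True
    then have "topological_weight X \<le>o topological_density X"
      using finite_Hausdorff_density_weight[OF X(2)] by blast
    then have "topological_density X =o \<nu>"
      using le ordLeq_transitive by (metis ordIso_iff_ordLeq)
    moreover have "dense_subset X (topspace X)" by (simp add: dense_subset_def)
    ultimately show ?thesis by (metis subtopology_topspace)
  next
    case False
    then show ?thesis
      using exists_dense_subspace_of_density[OF X _ f \<nu>] le by blast
  qed
qed

theorem theorem3p5:
  fixes X :: "'a topology"
  assumes "polyadic TYPE('m) TYPE('k) X"
  shows "(double_density_spectrum X :: 'l rel set) = cardinal_interval (topological_density X) (topological_weight X) \<and>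
    (\<forall>\<nu> :: 'l rel. Card_order \<nu> \<longrightarrow>
       ((\<exists>D. dense_subset X D \<and> topological_density (subtopology X D) =o \<nu>) \<longleftrightarrow>
        topological_density X \<le>o \<nu> \<and> \<nu> \<le>o topological_weight X))"
  using polyadic_dense_subspace_density_iff[OF assms]
  unfolding double_density_spectrum_def cardinal_interval_def by blast

end
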